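(* Let $A,B,\widetilde A,\widetilde B\in\mathbb{C}^{n\times n}$ with $\|A\|_2\le1$. Assume that $B$ is invertible and that the pencil $(A,B)$ has a full set of distinct, finite eigenvalues with corresponding eigenpairs $\{(\lambda_i,v_i)\}_{i=1}^n$, $\|v_i\|_2=1$. If $\|A-\widetilde A\|_2\le\varepsilon\,\sigma_n(B)\,\mathrm{gap}(A,B)$ and $\|B-\widetilde B\|_2\le\varepsilon\,\sigma_n^2(B)\,\mathrm{gap}(A,B)$ for $$\varepsilon\le\frac{1}{32\,\kappa_V(A,B)},$$ then $(\widetilde A,\widetilde B)$ has no repeated eigenvalues and any set of corresponding eigenpairs $\{(\widetilde\lambda_i,\widetilde v_i)\}_{i=1}^n$, $\|\widetilde v_i\|_2=1$, satisfies $$|\lambda_i-\widetilde\lambda_i|\le4\,\mathrm{gap}(A,B)\,\kappa_V(A,B)\,\varepsilon\quad\text{and}\quad\|v_i-\widetilde v_i\|_2\le24\,n\,\kappa_V(A,B)\,\varepsilon\quad\text{for all }i=1,\dots,n$$ after multiplying the $v_i$ by phases and reordering, if necessary.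
   Context: $\|\cdot\|_2$ is the spectral (Euclidean) norm and $\sigma_n(B)$ the smallest singular value of $B$. An eigenpair $(\lambda,v)$ of $(A,B)$ satisfies $Av=\lambda Bv$, $v\neq0$. $\mathrm{gap}(A,B)=\min_{i\ne j}|\lambda_i(A,B)-\lambda_j(A,B)|$, where the $\lambda_i(A,B)$ are the eigenvalues of $(A,B)$ repeated according to multiplicity. $\kappa_V(A,B)=\inf_T\kappa(T)$, the infimum over all invertible $T$ whose columns are a full set of right eigenvectors of $(A,B)$, with $\kappa(T)=\|T\|_2\|T^{-1}\|_2$. *)

theory Defs
  imports "HOL-Analysis.Analysis" "HOL-Computational_Algebra.Computational_Algebra"
begin

text \<open>The norm on \<^typ>\<open>complex^'n\<close> is the Euclidean norm, so this is the 2-norm of a matrix.\<close>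

definition spectral_norm :: "complex^'n^'m \<Rightarrow> real" where
  "spectral_norm A = onorm (\<lambda>x. A *v x)"

definition conj_transpose :: "complex^'n^'m \<Rightarrow> complex^'m^'n" where
  "conj_transpose A = (\<chi> i j. cnj (A $ j $ i))"

text \<open>For square matrices only: the nonnegative square roots of the eigenvalues of
  \<open>B\<^sup>* B\<close>.\<close>

definition singular_values :: "complex^'n^'n \<Rightarrow> real set" where
  "singular_values B =
     {s. 0 \<le> s \<and> (\<exists>x. x \<noteq> 0 \<and> (conj_transpose B ** B) *v x = complex_of_real (s\<^sup>2) *s x)}"

definition sigma_min :: "complex^'n^'n \<Rightarrow> real" where
  "sigma_min B = Min (singular_values B)"

definition eigenpair :: "complex^'n^'n \<Rightarrow> complex^'n^'n \<Rightarrow> complex \<Rightarrow> complex^'n \<Rightarrow> bool" where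
  "eigenpair A B l v \<longleftrightarrow> A *v v = l *s (B *v v) \<and> v \<noteq> 0"

text \<open>The polynomial \<open>det (A - z B)\<close> in \<open>z\<close>.\<close>

definition pencil_poly :: "complex^'n^'n \<Rightarrow> complex^'n^'n \<Rightarrow> complex poly" where
  "pencil_poly A B = det (\<chi> i j. [:A $ i $ j, - (B $ i $ j):])"

text \<open>The finite eigenvalues, repeated according to algebraic multiplicity. The pencil is regular
  without infinite eigenvalues iff there are \<open>n\<close> of them; for a singular pencil
  (zero polynomial) the multiset is empty.\<close>

definition pencil_eigenvalues :: "complex^'n^'n \<Rightarrow> complex^'n^'n \<Rightarrow> complex multiset" where
  "pencil_eigenvalues A B = proots (pencil_poly A B)"

definition distinct_finite_eigenvalues :: "complex^'n^'n \<Rightarrow> complex^'n^'n \<Rightarrow> bool" where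
  "distinct_finite_eigenvalues A B \<longleftrightarrow>
     size (pencil_eigenvalues A B) = CARD('n) \<and> (\<forall>z. count (pencil_eigenvalues A B) z \<le> 1)"

text \<open>A family of unit eigenpairs, indexed by \<^typ>\<open>'n\<close>, in which the first components
  enumerate the eigenvalues with multiplicity.\<close>

definition unit_eigenpairs ::
    "complex^'n^'n \<Rightarrow> complex^'n^'n \<Rightarrow> ('n \<Rightarrow> complex) \<Rightarrow> ('n \<Rightarrow> complex^'n) \<Rightarrow> bool" where
  "unit_eigenpairs A B l v \<longleftrightarrow>
     image_mset l (mset_set UNIV) = pencil_eigenvalues A B \<and>
     (\<forall>i. eigenpair A B (l i) (v i) \<and> norm (v i) = 1)"

text \<open>Two-element submultisets are the pairs of eigenvalues with different indices, so the gap is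
  zero if an eigenvalue is repeated. The minimum is meaningful only if there are at least
  two eigenvalues.\<close>

definition gap :: "complex^'n^'n \<Rightarrow> complex^'n^'n \<Rightarrow> real" where
  "gap A B = Min {cmod (x - y) | x y. {#x, y#} \<subseteq># pencil_eigenvalues A B}"

definition cond_number :: "complex^'n^'n \<Rightarrow> real" where
  "cond_number T = spectral_norm T * spectral_norm (matrix_inv T)"

definition kappa_V :: "complex^'n^'n \<Rightarrow> complex^'n^'n \<Rightarrow> real" where
  "kappa_V A B = Inf {cond_number T | T. invertible T \<and> (\<forall>j. \<exists>l. eigenpair A B l (column j T))}"

end

theory Submission
  imports Defs
begin

text \<open>With \<open>M = B\<^sup>-\<^sup>1 A\<close> and \<open>E = Bt\<^sup>-\<^sup>1 At - M\<close>, the hypotheses give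
  \<open>norm E \<le> 5/2 \<epsilon> gap\<close>, because the gap is at most \<open>2 / sigma_min B\<close>. If \<open>T\<close> diagonalises \<open>M\<close> and
  has nearly optimal condition number, \<open>T\<^sup>-\<^sup>1 (M + E) T\<close> is a diagonal matrix plus a perturbation that
  is small compared to the gap, and Brouwer's fixed point theorem yields an eigenvalue of \<open>M + E\<close>
  close to each \<open>l i\<close>. These \<open>n\<close> eigenvalues are distinct, hence they are all eigenvalues of the
  perturbed pencil. Expanding a unit eigenvector of \<open>M + E\<close> in the basis \<open>v\<close>, the coordinates with
  index different from \<open>i\<close> are at most \<open>kappa * norm E\<close> divided by the distance of the perturbed
  eigenvalue to the rest of the spectrum, and summing them gives the eigenvector bound.\<close>

no_notation fps_nth (infixl \<open>$\<close> 75)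

section \<open>Norms, matrix-vector products and inverses\<close>

lemma norm_vector_scalar_mult: "norm (c *s x) = cmod c * norm x" for x :: "complex^'n"
  by (simp add: norm_vec_def L2_set_right_distrib norm_mult)

lemma of_real_vector_scalar_mult: "complex_of_real c *s x = c *\<^sub>R x"
  unfolding vec_eq_iff vector_smult_component vector_scaleR_component
  by (simp add: scaleR_conv_of_real)

lemma norm_axis_one: "norm (axis i 1 :: complex^'n) = 1"
proof -
  have "norm (axis i 1 :: complex^'n) = sqrt (\<Sum>j\<in>UNIV. if j = i then 1 else 0)"
    unfolding norm_vec_def L2_set_def axis_def
    by (intro arg_cong[where f = sqrt] sum.cong) auto
  then show ?thesis by simp
qed

lemma matrix_vector_mult_scaleR_complex:
  "B *v (c *\<^sub>R x) = c *\<^sub>R (B *v x)" for B :: "complex^'n^'m"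
  by (rule linear_scale[OF matrix_vector_mul_linear])

lemma matrix_vector_mult_axis_one: "A *v axis k 1 = column k A"
  for A :: "'a::comm_semiring_1^'n^'m"
  by (simp add: vec_eq_iff matrix_vector_mult_def axis_def column_def if_distrib cong: if_cong)

lemma spectral_norm_bound: "norm (A *v x) \<le> spectral_norm A * norm x"
  unfolding spectral_norm_def by (rule onorm) simp

lemma spectral_norm_nonneg: "0 \<le> spectral_norm A"
  unfolding spectral_norm_def by (rule onorm_pos_le) simp

lemma matrix_inv_mult_vector:
  fixes B :: "complex^'n^'n"
  assumes "invertible B"
  shows "matrix_inv B *v (B *v x) = x" "B *v (matrix_inv B *v x) = x"
  proof -
  have "B ** matrix_inv B = mat 1 \<and> matrix_inv B ** B = mat 1"
    using assms unfolding invertible_def matrix_inv_def by (rule someI_ex)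
  then show "matrix_inv B *v (B *v x) = x" "B *v (matrix_inv B *v x) = x"
    by (simp_all add: matrix_vector_mul_assoc)
qed

lemma invertible_if_bounded_below:
  fixes B :: "complex^'n^'n"
  assumes "0 < c" "\<And>x. c * norm x \<le> norm (B *v x)"
  shows "invertible B"
  unfolding invertible_left_inverse matrix_left_invertible_ker
proof (intro allI impI)
  fix x assume "B *v x = 0"
  then show "x = 0" using assms(2)[of x] assms(1)
    by (simp add: mult_le_0_iff)
qed

lemma matrix_vector_mult_sum_right:
  fixes A :: "complex^'n^'m"
  shows "A *v (\<Sum>i\<in>S. f i) = (\<Sum>i\<in>S. A *v f i)"
  by (induction S rule: infinite_finite_induct) (simp_all add: matrix_vector_right_distrib)

section \<open>Eigenvalues of a pencil\<close>

text \<open>Multiplying by the inverse of \<open>B\<close> leaves an ordinary eigenvalue problem, on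
  which the perturbation argument runs.\<close>

lemma eigenpair_iff:
  fixes A B :: "complex^'n^'n"
  assumes "invertible B"
  shows "eigenpair A B z x \<longleftrightarrow> (matrix_inv B ** A) *v x = z *s x \<and> x \<noteq> 0"
proof -
  have "A *v x = z *s (B *v x) \<longleftrightarrow> matrix_inv B *v (A *v x) = z *s x"
    using matrix_inv_mult_vector[OF assms]
    by (metis vector_scalar_commute)
  then show ?thesis by (simp add: eigenpair_def matrix_vector_mul_assoc)
qed

lemma poly_det:
  fixes M :: "complex poly^'n^'n"
  shows "poly (det M) z = det (\<chi> i j. poly (M $ i $ j) z)"
  unfolding det_def by (simp add: poly_sum poly_prod)

lemma poly_pencil_poly:
  "poly (pencil_poly A B) z = det (A - (\<chi> i j. z * B $ i $ j))"
  unfolding pencil_poly_def poly_det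
  by (rule arg_cong[where f = det]) (simp add: vec_eq_iff)

lemma poly_pencil_poly_eq_0_iff:
  "poly (pencil_poly A B) z = 0 \<longleftrightarrow> (\<exists>x. eigenpair A B z x)"
proof -
  have "(A - (\<chi> i j. z * B $ i $ j)) *v x = A *v x - z *s (B *v x)" for x
    by (simp add: vec_eq_iff matrix_vector_mult_def sum_subtractf sum_distrib_left
        left_diff_distrib mult.assoc)
  then show ?thesis
    unfolding poly_pencil_poly eigenpair_def
    using invertible_det_nz[of "A - (\<chi> i j. z * B $ i $ j)"]
    unfolding invertible_left_inverse matrix_left_invertible_ker by auto
qed

text \<open>Every eigenvalue of \<open>matrix_inv B ** A\<close> has modulus at most the spectral
  norm \<open>K\<close> of that matrix, so \<open>K + 1\<close> cannot be a root.\<close>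

lemma pencil_poly_neq_0:
  fixes A B :: "complex^'n^'n"
  assumes "invertible B"
  shows "pencil_poly A B \<noteq> 0"
proof
  define K where "K = spectral_norm (matrix_inv B ** A)"
  assume "pencil_poly A B = 0"
  then have "poly (pencil_poly A B) (of_real (K + 1)) = 0" by simp
  then obtain x where x: "A *v x = of_real (K + 1) *s (B *v x)" "x \<noteq> 0"
    unfolding poly_pencil_poly_eq_0_iff eigenpair_def by blast
  have "(matrix_inv B ** A) *v x = of_real (K + 1) *s x"
    using x(1) matrix_inv_mult_vector[OF assms]
    by (simp add: matrix_vector_mul_assoc[symmetric] vector_scalar_commute[symmetric])
  then have "norm (of_real (K + 1) *s x) \<le> K * norm x"
    using spectral_norm_bound[of "matrix_inv B ** A" x] by (simp add: K_def)
  moreover have "0 \<le> K" by (simp add: K_def spectral_norm_nonneg)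
  ultimately have "(K + 1) * norm x \<le> K * norm x"
    by (simp only: norm_vector_scalar_mult norm_of_real)
  then show False using x(2) by (simp add: distrib_right)
qed

text \<open>In the Leibniz expansion each summand is a product of \<open>CARD('n)\<close> entries of
  degree at most one.\<close>

lemma degree_pencil_poly_le: "degree (pencil_poly A B) \<le> CARD('n)"
  for A B :: "complex^'n^'n"
  unfolding pencil_poly_def det_def
proof (intro degree_sum_le)
  fix p assume "p \<in> {p. p permutes (UNIV :: 'n set)}"
  let ?M = "\<chi> i j. [:A $ i $ j, - (B $ i $ j):]"
  have "degree (of_int (sign p) * (\<Prod>i\<in>UNIV. ?M $ i $ p i)) \<le> degree (\<Prod>i\<in>UNIV. ?M $ i $ p i)"
    using degree_mult_le[of "of_int (sign p)" "\<Prod>i\<in>UNIV. ?M $ i $ p i"] by simp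
  also have "\<dots> \<le> (\<Sum>i\<in>UNIV. degree (?M $ i $ p i))"
    using degree_prod_sum_le[of UNIV "\<lambda>i. ?M $ i $ p i"] by (simp add: o_def)
  also have "\<dots> \<le> (\<Sum>i\<in>(UNIV :: 'n set). 1)"
    by (intro sum_mono) simp
  finally show "degree (of_int (sign p) * (\<Prod>i\<in>UNIV. ?M $ i $ p i)) \<le> CARD('n)"
    by simp
qed (simp add: finite_permutations)

text \<open>Counting: \<open>CARD('n)\<close> distinct roots of a nonzero polynomial of degree at
  most \<open>CARD('n)\<close> exhaust its roots and are simple. Thus eigenvalues found one by one
  make up the whole spectrum.\<close>

lemma pencil_eigenvalues_eq_image_mset:
  fixes A B :: "complex^'n^'n" and \<mu> :: "'n \<Rightarrow> complex"
  assumes "invertible B" "inj \<mu>" "\<And>i. \<exists>x. eigenpair A B (\<mu> i) x"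
  shows "pencil_eigenvalues A B = image_mset \<mu> (mset_set UNIV)"
proof -
  let ?P = "pencil_eigenvalues A B"
  have nz: "pencil_poly A B \<noteq> 0" by (rule pencil_poly_neq_0) fact
  have "range \<mu> \<subseteq> set_mset ?P"
    using assms(3) nz by (auto simp: pencil_eigenvalues_def poly_pencil_poly_eq_0_iff)
  then have sub: "mset_set (range \<mu>) \<subseteq># ?P"
    by (metis finite_set_mset mset_set_set_mset_msubset msubset_mset_set_iff finite_subset
        subset_mset.order_trans)
  have "size ?P \<le> CARD('n)"
    using size_proots_le[of "pencil_poly A B"] degree_pencil_poly_le[of A B]
    by (simp add: pencil_eigenvalues_def)
  also have "\<dots> = size (mset_set (range \<mu>))"
    by (simp add: card_image assms(2))
  finally have "mset_set (range \<mu>) = ?P"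
    using sub by (metis leD mset_subset_size subset_mset.le_imp_less_or_eq)
  then show ?thesis
    using assms(2) by (simp add: image_mset_mset_set)
qed

lemma distinct_finite_eigenvalues_iff_inj:
  fixes A B :: "complex^'n^'n"
  assumes "pencil_eigenvalues A B = image_mset l (mset_set (UNIV :: 'n set))"
  shows "distinct_finite_eigenvalues A B \<longleftrightarrow> inj l"
proof -
  have "count (pencil_eigenvalues A B) z = card (l -` {z})" for z
    by (simp add: assms count_image_mset)
  then have "distinct_finite_eigenvalues A B \<longleftrightarrow> (\<forall>z. card (l -` {z}) \<le> 1)"
    unfolding distinct_finite_eigenvalues_def by (simp add: assms)
  also have "\<dots> \<longleftrightarrow> inj l"
    by (auto simp: card_le_Suc0_iff_eq inj_def)
  finally show ?thesis .
qed

section \<open>The eigenvalue gap\<close>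

lemma finite_gap_set: "finite {cmod (x - y) | x y. {#x, y#} \<subseteq># P}"
proof (rule finite_subset)
  show "{cmod (x - y) | x y. {#x, y#} \<subseteq># P} \<subseteq> (\<lambda>(x, y). cmod (x - y)) ` (set_mset P \<times> set_mset P)"
  proof clarify
    fix x y assume "{#x, y#} \<subseteq># P"
    then have "(x, y) \<in> set_mset P \<times> set_mset P" by (auto dest: mset_subset_eqD)
    then show "cmod (x - y) \<in> (\<lambda>(x, y). cmod (x - y)) ` (set_mset P \<times> set_mset P)"
      by (rule rev_image_eqI) simp
  qed
qed simp

lemma gap_set_memI:
  fixes l :: "'n::finite \<Rightarrow> complex"
  assumes "i \<noteq> j"
  shows "cmod (l i - l j) \<in> {cmod (x - y) | x y. {#x, y#} \<subseteq># image_mset l (mset_set UNIV)}"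
proof -
  have "mset_set {i, j} \<subseteq># mset_set UNIV" by (rule subset_imp_msubset_mset_set) auto
  from image_mset_subseteq_mono[OF this, of l] assms
  have "{#l i, l j#} \<subseteq># image_mset l (mset_set UNIV)" by simp
  then show ?thesis by blast
qed

lemma gap_le:
  fixes A B :: "complex^'n^'n"
  assumes "pencil_eigenvalues A B = image_mset l (mset_set (UNIV :: 'n set))" "i \<noteq> j"
  shows "gap A B \<le> cmod (l i - l j)"
  unfolding gap_def assms(1) by (intro Min_le finite_gap_set gap_set_memI assms(2))

text \<open>With at least two indices the set of distances is nonempty, so the minimum is attained
  by an actual pair of eigenvalues.\<close>

lemma gap_pos:
  fixes A B :: "complex^'n^'n"
  assumes "CARD('n) \<ge> 2" "pencil_eigenvalues A B = image_mset l (mset_set (UNIV :: 'n set))" "inj l"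
  shows "0 < gap A B"
proof -
  let ?S = "{cmod (x - y) | x y. {#x, y#} \<subseteq># pencil_eigenvalues A B}"
  obtain i j :: 'n where "i \<noteq> j"
    using assms(1) by (metis One_nat_def card_le_Suc0_iff_eq finite not_less_eq_eq numeral_2_eq_2 UNIV_I)
  then have "?S \<noteq> {}" using gap_set_memI[of i j l] assms(2) by auto
  then have "gap A B \<in> ?S" unfolding gap_def by (intro Min_in finite_gap_set)
  then obtain x y where xy: "gap A B = cmod (x - y)" "{#x, y#} \<subseteq># pencil_eigenvalues A B" by blast
  have "pencil_eigenvalues A B = mset_set (range l)"
    using assms(2,3) by (simp add: image_mset_mset_set)
  \<comment> \<open>If \<open>x = y\<close>, this value would occur twice, but counts in
    \<open>mset_set\<close> are at most one.\<close>
  then have "x \<noteq> y"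
    using mset_subset_eq_count[OF xy(2), of x] by (auto simp: count_mset_set' split: if_splits)
  then show ?thesis using xy(1) by simp
qed

section \<open>The smallest singular value\<close>

lemma norm_add_scaleR_sq:
  "(norm (a + t *\<^sub>R b))\<^sup>2 = (norm a)\<^sup>2 + 2 * t * inner a b + t\<^sup>2 * (norm b)\<^sup>2"
  for a b :: "'a::real_inner"
  unfolding power2_norm_eq_inner
  by (simp add: inner_add_left inner_add_right inner_commute power2_eq_square algebra_simps)

text \<open>\<open>inner\<close> on complex vectors is the real part of the Hermitian product, so
  the conjugate transpose is the adjoint here too.\<close>

lemma inner_conj_transpose_mult:
  "inner (conj_transpose B *v y) x = inner y (B *v x)"
proof -
  have "inner (conj_transpose B *v y) x
      = (\<Sum>j\<in>UNIV. \<Sum>i\<in>UNIV. inner (cnj (B $ i $ j) * y $ i) (x $ j))"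
    by (simp add: inner_vec_def matrix_vector_mult_def conj_transpose_def inner_sum_left)
  also have "\<dots> = (\<Sum>i\<in>UNIV. \<Sum>j\<in>UNIV. inner (cnj (B $ i $ j) * y $ i) (x $ j))"
    by (rule sum.swap)
  also have "\<dots> = (\<Sum>i\<in>UNIV. \<Sum>j\<in>UNIV. inner (y $ i) (B $ i $ j * x $ j))"
    by (simp add: inner_complex_def algebra_simps)
  also have "\<dots> = inner y (B *v x)"
    by (simp add: inner_vec_def matrix_vector_mult_def inner_sum_right)
  finally show ?thesis .
qed

lemma norm_singular_vector:
  assumes "(conj_transpose B ** B) *v x = complex_of_real (s\<^sup>2) *s x"
  shows "(norm (B *v x))\<^sup>2 = s\<^sup>2 * (norm x)\<^sup>2"
proof -
  have "(norm (B *v x))\<^sup>2 = inner ((conj_transpose B ** B) *v x) x"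
    by (simp add: power2_norm_eq_inner inner_conj_transpose_mult flip: matrix_vector_mul_assoc)
  also have "\<dots> = inner (s\<^sup>2 *\<^sub>R x) x"
    unfolding assms of_real_vector_scalar_mult ..
  finally show ?thesis by (simp add: power2_norm_eq_inner)
qed

text \<open>Squares of singular values are roots of a nonzero polynomial, and squaring is injective
  on nonnegative reals. Finiteness gives the \<open>Min\<close> in \<open>sigma_min\<close> its
  meaning.\<close>

lemma finite_singular_values: "finite (singular_values B)"
proof -
  have "finite {z. poly (pencil_poly (conj_transpose B ** B) (mat 1)) z = 0}"
    by (intro poly_roots_finite pencil_poly_neq_0 exI[of _ "mat 1"]) (simp add: invertible_def)
  moreover have "(\<lambda>s. complex_of_real (s\<^sup>2)) ` singular_values B
      \<subseteq> {z. poly (pencil_poly (conj_transpose B ** B) (mat 1)) z = 0}"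
    unfolding poly_pencil_poly_eq_0_iff eigenpair_def singular_values_def by auto
  moreover have "inj_on (\<lambda>s. complex_of_real (s\<^sup>2)) (singular_values B)"
    by (auto simp: inj_on_def singular_values_def simp del: of_real_power)
  ultimately show ?thesis
    using finite_imageD finite_subset by blast
qed

text \<open>A minimiser of \<open>norm (B *v x)\<close> on the unit sphere is a singular vector, because the
  form \<open>(norm (B *v x))\<^sup>2 - s\<^sup>2 * (norm x)\<^sup>2\<close> is nonnegative and vanishes there.\<close>

lemma singular_value_minimal:
  fixes B :: "complex^'n^'n"
  obtains s where "s \<in> singular_values B" "\<And>x. s * norm x \<le> norm (B *v x)"
proof -
  have "continuous_on (sphere 0 1) (\<lambda>x. norm (B *v x))"
    by (intro continuous_on_norm linear_continuous_on) simp
  moreover have "norm (axis undefined 1 :: complex^'n) = 1"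
    by (simp add: norm_axis_one)
  then have "(sphere 0 1 :: (complex^'n) set) \<noteq> {}"
    by (metis dist_0_norm empty_iff mem_sphere)
  ultimately obtain u where u: "norm u = 1"
    and min: "\<And>x. norm x = 1 \<Longrightarrow> norm (B *v u) \<le> norm (B *v x)"
    using continuous_attains_inf[of "sphere 0 1 :: (complex^'n) set" "\<lambda>x. norm (B *v x)"]
    by auto
  define s where "s = norm (B *v u)"
  have bound: "s * norm x \<le> norm (B *v x)" for x
  proof (cases "x = 0")
    case False
    then have "s \<le> norm (B *v ((1 / norm x) *\<^sub>R x))"
      unfolding s_def by (intro min) simp
    then show ?thesis
      using False by (simp add: matrix_vector_mult_scaleR_complex field_simps)
  qed simp
  \<comment> \<open>\<open>z\<close> is half the gradient of the form at \<open>u\<close>, and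
    \<open>c\<close> below is the value of the form at \<open>z\<close>. It remains to show
    \<open>z = 0\<close>.\<close>
  define z where "z = conj_transpose B *v (B *v u) - s\<^sup>2 *\<^sub>R u"
  define c where "c = (norm (B *v z))\<^sup>2 - s\<^sup>2 * (norm z)\<^sup>2"
  have "s\<^sup>2 * (norm z)\<^sup>2 \<le> (norm (B *v z))\<^sup>2"
    using power_mono[OF bound[of z], of 2] by (simp add: s_def power_mult_distrib)
  then have "0 \<le> c" by (simp add: c_def)
  have quad: "0 \<le> 2 * t * (norm z)\<^sup>2 + t\<^sup>2 * c" for t
  proof -
    have "s\<^sup>2 * (norm (u + t *\<^sub>R z))\<^sup>2 \<le> (norm (B *v (u + t *\<^sub>R z)))\<^sup>2"
      using power_mono[OF bound[of "u + t *\<^sub>R z"], of 2] by (simp add: s_def power_mult_distrib)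
    also have "\<dots> = s\<^sup>2 + 2 * t * inner (B *v u) (B *v z) + t\<^sup>2 * (norm (B *v z))\<^sup>2"
      unfolding matrix_vector_right_distrib matrix_vector_mult_scaleR_complex norm_add_scaleR_sq s_def ..
    also have "inner (B *v u) (B *v z) = (norm z)\<^sup>2 + s\<^sup>2 * inner u z"
      unfolding inner_conj_transpose_mult[symmetric]
      by (simp add: power2_norm_eq_inner z_def inner_diff_left)
    also have "s\<^sup>2 * (norm (u + t *\<^sub>R z))\<^sup>2 = s\<^sup>2 * (1 + 2 * t * inner u z + t\<^sup>2 * (norm z)\<^sup>2)"
      unfolding norm_add_scaleR_sq u by simp
    finally show ?thesis by (simp add: c_def algebra_simps)
  qed
  have "z = 0"
  proof (rule ccontr)
    assume "z \<noteq> 0"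
    \<comment> \<open>The step \<open>t = - q\<close> against the gradient makes the quadratic
      negative. The denominator \<open>c + 1\<close> is positive even if
      \<open>c = 0\<close>.\<close>
    define q where "q = (norm z)\<^sup>2 / (c + 1)"
    have q: "0 < q" "(norm z)\<^sup>2 = q * (c + 1)"
      using \<open>z \<noteq> 0\<close> \<open>0 \<le> c\<close> by (simp_all add: q_def)
    have "0 \<le> 2 * (- q) * (norm z)\<^sup>2 + (- q)\<^sup>2 * c" by (rule quad)
    also have "\<dots> = - (q\<^sup>2 * (c + 2))"
      unfolding q(2) by (simp add: power2_eq_square algebra_simps)
    also have "\<dots> < 0" using q(1) \<open>0 \<le> c\<close> by simp
    finally show False by simp
  qed
  then have "(conj_transpose B ** B) *v u = complex_of_real (s\<^sup>2) *s u"
    unfolding of_real_vector_scalar_mult by (simp add: z_def flip: matrix_vector_mul_assoc)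
  then have "s \<in> singular_values B"
    using u unfolding singular_values_def s_def mem_Collect_eq
    by (intro conjI exI[of _ u]) auto
  then show ?thesis using bound that by blast
qed

text \<open>A singular vector \<open>x\<close> for \<open>t\<close> satisfies
  \<open>norm (B *v x) = t * norm x\<close>, so a lower bound \<open>s\<close> valid for all vectors
  is at most \<open>t\<close>. This links the eigenvalue definition with the variational
  one.\<close>

lemma sigma_min_eqI:
  fixes B :: "complex^'n^'n"
  assumes "s \<in> singular_values B" "\<And>x. s * norm x \<le> norm (B *v x)"
  shows "sigma_min B = s"
  unfolding sigma_min_def
proof (rule Min_eqI[OF finite_singular_values])
  fix t assume "t \<in> singular_values B"
  then obtain x where "0 \<le> t" "x \<noteq> 0"
    and "(conj_transpose B ** B) *v x = complex_of_real (t\<^sup>2) *s x"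
    unfolding singular_values_def by blast
  then have "(norm (B *v x))\<^sup>2 = (t * norm x)\<^sup>2"
    using norm_singular_vector by (simp add: power_mult_distrib)
  then have "norm (B *v x) = t * norm x"
    using \<open>0 \<le> t\<close> by (simp add: power2_eq_iff_nonneg)
  then show "s \<le> t" using assms(2)[of x] \<open>x \<noteq> 0\<close> by simp
qed (fact assms)

lemma sigma_min_mult_le: "sigma_min B * norm x \<le> norm (B *v x)"
  by (metis singular_value_minimal sigma_min_eqI)

lemma sigma_min_pos:
  assumes "invertible B"
  shows "0 < sigma_min B"
proof -
  obtain s where s: "s \<in> singular_values B" "\<And>x. s * norm x \<le> norm (B *v x)"
    using singular_value_minimal by blast
  then obtain x where "0 \<le> s" "x \<noteq> 0"
    and x: "(conj_transpose B ** B) *v x = complex_of_real (s\<^sup>2) *s x"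
    unfolding singular_values_def by blast
  have "B *v x \<noteq> 0"
    using matrix_inv_mult_vector(1)[OF assms, of x] \<open>x \<noteq> 0\<close> by auto
  then have "s \<noteq> 0" using norm_singular_vector[OF x] by auto
  then show ?thesis using \<open>0 \<le> s\<close> sigma_min_eqI[OF s] by simp
qed

section \<open>Perturbation of a diagonalisable matrix\<close>

text \<open>Normalising \<open>x $ i = 1\<close> turns the eigenvalue equation into a fixed point equation for the
  other components.\<close>

lemma diagonal_perturbation_eigenvector:
  fixes F :: "complex^'n^'n" and d :: "'n \<Rightarrow> complex"
  assumes F: "\<And>x. norm (F *v x) \<le> r * norm x" and "10 * r \<le> g" and "0 < g"
    and sep: "\<And>j. j \<noteq> i \<Longrightarrow> g \<le> cmod (d i - d j)"
  obtains \<mu> x where "x \<noteq> 0" "\<And>j. d j * x $ j + (F *v x) $ j = \<mu> * x $ j"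
    "cmod (\<mu> - d i) \<le> 5 / 4 * r"
proof -
  let ?e = "axis i 1 :: complex^'n"
  \<comment> \<open>The \<open>i\<close>-th equation gives
    \<open>\<mu> = d i + (F *v x) $ i\<close>; inserting this into the others and solving for
    \<open>x $ j\<close> gives the quotients.\<close>
  define \<Phi> where "\<Phi> x = (\<chi> j. if j = i then 1 else (F *v x) $ j / (d i + (F *v x) $ i - d j))" for x
  have r: "0 \<le> r"
    using order_trans[OF norm_ge_zero F[of ?e]] by (simp add: norm_axis_one)
  have Fx: "norm (F *v x) \<le> 5 / 4 * r" if "x \<in> cball ?e (1 / 4)" for x
  proof -
    have "norm x \<le> norm ?e + norm (x - ?e)" using norm_triangle_ineq[of ?e "x - ?e"] by simp
    also have "\<dots> \<le> 5 / 4" using that by (simp add: norm_axis_one dist_norm norm_minus_commute)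
    finally have "r * norm x \<le> r * (5 / 4)" using r by (rule mult_left_mono)
    then show ?thesis using F[of x] by simp
  qed
  \<comment> \<open>At most \<open>5 / 4 * r \<le> g / 8\<close> is lost from the separation
    \<open>g\<close>.\<close>
  have den: "7 / 8 * g \<le> cmod (d i + (F *v x) $ i - d j)" if "x \<in> cball ?e (1 / 4)" "j \<noteq> i" for x j
  proof -
    have "g \<le> cmod (d i - d j)" using sep that by simp
    also have "\<dots> \<le> cmod (d i + (F *v x) $ i - d j) + cmod ((F *v x) $ i)"
      using norm_triangle_ineq4[of "d i + (F *v x) $ i - d j" "(F *v x) $ i"] by simp
    also have "cmod ((F *v x) $ i) \<le> g / 8"
      using Finite_Cartesian_Product.norm_nth_le[of "F *v x" i] Fx[OF that(1)] \<open>10 * r \<le> g\<close> by simp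
    finally show ?thesis by simp
  qed
  have "continuous_on (cball ?e (1 / 4)) \<Phi>"
    unfolding \<Phi>_def
  proof (rule continuous_on_vec_lambda)
    fix j
    have F_cont: "continuous_on (cball ?e (1 / 4)) (\<lambda>x. (F *v x) $ k)" for k
      by (intro bounded_linear.continuous_on[OF bounded_linear_vec_nth] linear_continuous_on) simp
    have "d i + (F *v x) $ i - d j \<noteq> 0" if "x \<in> cball ?e (1 / 4)" "j \<noteq> i" for x
      using den[OF that] \<open>0 < g\<close> by auto
    then show "continuous_on (cball ?e (1 / 4))
        (\<lambda>x. if j = i then 1 else (F *v x) $ j / (d i + (F *v x) $ i - d j))"
      by (cases "j = i") (auto intro!: continuous_intros F_cont)
  qed
  moreover have "\<Phi> \<in> cball ?e (1 / 4) \<rightarrow> cball ?e (1 / 4)"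
  proof
    fix x assume x: "x \<in> cball ?e (1 / 4)"
    \<comment> \<open>The \<open>i\<close>-th component of the difference is zero, and the other
      denominators are at least \<open>7 / 8 * g\<close>. The total is at most \<open>1 / 7\<close>,
      below the radius \<open>1 / 4\<close>.\<close>
    have "norm ((\<Phi> x - ?e) $ j) \<le> norm (((8 / (7 * g)) *\<^sub>R (F *v x)) $ j)" for j
    proof (cases "j = i")
      case False
      have "cmod ((F *v x) $ j) / cmod (d i + (F *v x) $ i - d j) \<le> cmod ((F *v x) $ j) / (7 / 8 * g)"
        using den[OF x False] \<open>0 < g\<close> by (intro divide_left_mono mult_pos_pos) auto
      then show ?thesis
        using False \<open>0 < g\<close> by (simp add: \<Phi>_def axis_def norm_divide)
    qed (simp add: \<Phi>_def)
    then have "norm (\<Phi> x - ?e) \<le> norm ((8 / (7 * g)) *\<^sub>R (F *v x))"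
      by (rule norm_le_componentwise_cart)
    also have "\<dots> = 8 / (7 * g) * norm (F *v x)" using \<open>0 < g\<close> by simp
    also have "\<dots> \<le> 8 / (7 * g) * (g / 8)"
      using Fx[OF x] \<open>10 * r \<le> g\<close> \<open>0 < g\<close> by (intro mult_left_mono) auto
    also have "\<dots> \<le> 1 / 4" using \<open>0 < g\<close> by simp
    finally show "\<Phi> x \<in> cball ?e (1 / 4)" by (simp add: dist_norm norm_minus_commute)
  qed
  ultimately obtain x where x: "x \<in> cball ?e (1 / 4)" and fixed: "\<Phi> x = x"
    using brouwer[of "cball ?e (1 / 4)" \<Phi>] by auto
  have xi: "x $ i = 1" by (subst fixed[symmetric]) (simp add: \<Phi>_def)
  have xj: "x $ j = (F *v x) $ j / (d i + (F *v x) $ i - d j)" if "j \<noteq> i" for j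
    by (subst fixed[symmetric]) (simp add: \<Phi>_def that)
  show ?thesis
  proof
    show "x \<noteq> 0" using xi by auto
    show "d j * x $ j + (F *v x) $ j = (d i + (F *v x) $ i) * x $ j" for j
    proof (cases "j = i")
      case False
      then have "d i + (F *v x) $ i - d j \<noteq> 0"
        using den[OF x False] \<open>0 < g\<close> by auto
      then have "x $ j * (d i + (F *v x) $ i - d j) = (F *v x) $ j"
        using xj[OF False] by simp
      then show ?thesis by (simp add: algebra_simps)
    qed (simp add: xi)
    show "cmod (d i + (F *v x) $ i - d i) \<le> 5 / 4 * r"
      using Finite_Cartesian_Product.norm_nth_le[of "F *v x" i] Fx[OF x] by simp
  qed
qed

text \<open>If \<open>c\<close> is the phase of \<open>a\<close>, then
  \<open>cmod (c - a) = \<bar>1 - cmod a\<bar>\<close> is the difference of the norms of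
  \<open>w\<close> and \<open>a *s v\<close>. The reverse triangle inequality bounds it by
  \<open>norm (w - a *s v)\<close>, whence the factor 2.\<close>

lemma phase_alignment:
  fixes v w :: "complex^'n"
  assumes "norm v = 1" "norm w = 1"
  obtains c where "cmod c = 1" "norm (c *s v - w) \<le> 2 * norm (w - a *s v)"
proof
  \<comment> \<open>\<open>sgn 0\<close> is 0 and hence no phase, so the case \<open>a = 0\<close>
    takes 1.\<close>
  define c where "c = (if a = 0 then 1 else sgn a)"
  show "cmod c = 1" by (simp add: c_def norm_sgn)
  have "a = cmod a * c" by (simp add: c_def sgn_eq)
  then have "cmod (c - a) = cmod (of_real (1 - cmod a) * c)"
    by (simp add: algebra_simps)
  also have "\<dots> = \<bar>1 - cmod a\<bar>"
    using \<open>cmod c = 1\<close> by (simp only: norm_mult norm_of_real mult_1_right)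
  also have "\<dots> = \<bar>norm w - norm (a *s v)\<bar>"
    using assms by (simp add: norm_vector_scalar_mult)
  also have "\<dots> \<le> norm (w - a *s v)" by (rule norm_triangle_ineq3)
  finally have "norm ((c - a) *s v) \<le> norm (w - a *s v)"
    by (simp only: norm_vector_scalar_mult assms(1) mult_1_right)
  then have "norm ((c - a) *s v - (w - a *s v)) \<le> 2 * norm (w - a *s v)"
    using norm_triangle_ineq4[of "(c - a) *s v" "w - a *s v"] by simp
  then show "norm (c *s v - w) \<le> 2 * norm (w - a *s v)"
    by (simp add: vector_ssub_ldistrib vec.scale_left_diff_distrib)
qed

text \<open>Induction on the index set: applying \<open>M - l k\<close> to a vanishing combination
  removes the term of \<open>k\<close> and multiplies the others by the nonzero factors
  \<open>l i - l k\<close>.\<close>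

lemma distinct_eigenvectors_independent:
  fixes M :: "complex^'n^'n" and l :: "'i \<Rightarrow> complex"
  assumes M: "\<And>i. M *v v i = l i *s v i" and v: "\<And>i. v i \<noteq> 0" and "inj l" and "finite S"
  shows "(\<Sum>i\<in>S. x i *s v i) = 0 \<Longrightarrow> \<forall>i\<in>S. x i = 0"
  using \<open>finite S\<close>
proof (induction S arbitrary: x)
  case (insert k S)
  have "0 = M *v (\<Sum>i\<in>insert k S. x i *s v i) - l k *s (\<Sum>i\<in>insert k S. x i *s v i)"
    using insert.prems by simp
  also have "\<dots> = (\<Sum>i\<in>insert k S. ((l i - l k) * x i) *s v i)"
    unfolding matrix_vector_mult_sum_right
    by (simp add: M vector_scalar_commute vec_eq_iff left_diff_distrib algebra_simps
        sum_subtractf sum_distrib_left)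
  also have "\<dots> = (\<Sum>i\<in>S. ((l i - l k) * x i) *s v i)"
    using insert.hyps by simp
  finally have "\<forall>i\<in>S. (l i - l k) * x i = 0"
    by (intro insert.IH) simp
  then have "\<forall>i\<in>S. x i = 0"
    using insert.hyps(2) \<open>inj l\<close> by (auto dest: injD)
  moreover from this have "x k *s v k = 0"
    using insert.prems insert.hyps by simp
  ultimately show ?case using v by simp
qed simp

section \<open>Coordinates in a basis of unit eigenvectors\<close>

locale eigenbasis =
  fixes M :: "complex^'n^'n" and l :: "'n \<Rightarrow> complex" and v :: "'n \<Rightarrow> complex^'n"
  assumes eigen: "M *v v i = l i *s v i" and norm_v: "norm (v i) = 1" and inj_l: "inj l"
begin

lemma independent: "(\<Sum>i\<in>UNIV. x i *s v i) = 0 \<Longrightarrow> x k = 0"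
  using distinct_eigenvectors_independent[of M v l UNIV x] eigen norm_v inj_l
  by (metis UNIV_I finite norm_zero zero_neq_one)

lemma coordinates_unique:
  assumes "(\<Sum>i\<in>UNIV. x i *s v i) = (\<Sum>i\<in>UNIV. y i *s v i)"
  shows "x k = y k"
  using independent[of "\<lambda>i. x i - y i"] assms
  by (simp add: vec.scale_left_diff_distrib sum_subtractf)

definition V :: "complex^'n^'n" where "V = (\<chi> i j. v j $ i)"

lemma column_V: "column j V = v j"
  by (simp add: column_def V_def vec_eq_iff)

lemma invertible_V: "invertible V"
  unfolding invertible_left_inverse matrix_left_invertible_ker matrix_mult_sum column_V
  using independent by (simp add: vec_eq_iff)

lemma coordinates:
  obtains x where "w = (\<Sum>i\<in>UNIV. x i *s v i)"
proof
  show "w = (\<Sum>i\<in>UNIV. (matrix_inv V *v w) $ i *s v i)"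
    using matrix_inv_mult_vector(2)[OF invertible_V, of w] unfolding matrix_mult_sum column_V ..
qed

lemma mult_coordinates: "M *v (\<Sum>i\<in>UNIV. x i *s v i) = (\<Sum>i\<in>UNIV. (l i * x i) *s v i)"
  by (simp add: matrix_vector_mult_sum_right vector_scalar_commute eigen mult.commute)

text \<open>Comparing coordinates on both sides gives \<open>l i * x i = z * x i\<close>; since the
  \<open>l i\<close> are distinct, only one coordinate is nonzero.\<close>

lemma eigenvector_multiple:
  assumes "M *v t = z *s t" "t \<noteq> 0"
  obtains k a where "a \<noteq> 0" "t = a *s v k" "z = l k"
proof -
  obtain x where x: "t = (\<Sum>i\<in>UNIV. x i *s v i)" by (rule coordinates)
  have "(\<Sum>i\<in>UNIV. (l i * x i) *s v i) = (\<Sum>i\<in>UNIV. (z * x i) *s v i)"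
    using assms(1) unfolding x mult_coordinates by (simp add: vec.scale_sum_right)
  then have eq: "l i * x i = z * x i" for i by (rule coordinates_unique)
  obtain k where k: "x k \<noteq> 0" using assms(2) x by force
  have "z = l k" using eq[of k] k by simp
  then have "x i = 0" if "i \<noteq> k" for i
    using eq[of i] that inj_l by (auto dest: injD)
  then have "t = (\<Sum>i\<in>UNIV. if i = k then x k *s v k else 0)"
    unfolding x by (intro sum.cong) auto
  then have "t = x k *s v k" by simp
  then show ?thesis using that k \<open>z = l k\<close> by blast
qed

section \<open>Eigenvector matrices and their condition numbers\<close>

definition eigenmatrices :: "(complex^'n^'n) set" where
  "eigenmatrices = {T. invertible T \<and> (\<forall>j. \<exists>z. M *v column j T = z *s column j T \<and> column j T \<noteq> 0)}"

lemma V_eigenmatrix: "V \<in> eigenmatrices"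
proof -
  have "v j \<noteq> 0" for j using norm_v[of j] by auto
  then show ?thesis
    using eigen invertible_V unfolding eigenmatrices_def mem_Collect_eq column_V by blast
qed

text \<open>Simple eigenvalues make each column a nonzero multiple of some \<open>v k\<close>. Two
  columns parallel to the same \<open>v k\<close> would contradict invertibility, so
  \<open>q\<close> is a permutation.\<close>

lemma eigenmatrix_columns:
  assumes "T \<in> eigenmatrices"
  obtains q a where "bij q" "\<And>j. column j T = a j *s v (q j)"
proof -
  have "\<forall>j. \<exists>k a. a \<noteq> 0 \<and> column j T = a *s v k"
  proof
    fix j
    obtain z where "M *v column j T = z *s column j T" "column j T \<noteq> 0"
      using assms by (auto simp: eigenmatrices_def)
    then obtain k a where "a \<noteq> 0" "column j T = a *s v k"
      by (rule eigenvector_multiple)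
    then show "\<exists>k a. a \<noteq> 0 \<and> column j T = a *s v k" by blast
  qed
  then obtain q a where qa: "\<And>j. a j \<noteq> 0" "\<And>j. column j T = a j *s v (q j)" by metis
  have inj_T: "T *v x = 0 \<Longrightarrow> x = 0" for x
    using assms matrix_inv_mult_vector(1)[of T x] by (auto simp: eigenmatrices_def)
  have "inj q"
  proof (rule injI, rule ccontr)
    fix j k assume jk: "q j = q k" "j \<noteq> k"
    \<comment> \<open>This nonzero vector cancels the parallel columns \<open>j\<close> and
      \<open>k\<close>.\<close>
    have "T *v (a k *s axis j 1 - a j *s axis k 1) = 0"
      by (simp add: matrix_vector_mult_diff_distrib vector_scalar_commute matrix_vector_mult_axis_one
          qa(2) jk mult.commute)
    from inj_T[OF this] have "(a k *s axis j 1 - a j *s axis k 1 :: complex^'n) $ j = 0" by simp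
    then show False using jk(2) qa(1)[of k] by (simp add: axis_def)
  qed
  then have "bij q" by (simp add: bij_def finite_UNIV_inj_surj)
  then show ?thesis using qa(2) that by blast
qed

text \<open>Since \<open>norm (a j)\<close> is at most the norm of \<open>T\<close>, rescaling the columns of \<open>T\<close> to unit length
  leaves an inverse of norm at most the condition number of \<open>T\<close>. This keeps the eigenvector
  bound linear in \<open>kappa\<close>.\<close>

lemma coordinate_le_cond_number:
  assumes T: "T \<in> eigenmatrices"
  shows "cmod (x k) \<le> cond_number T * norm (\<Sum>i\<in>UNIV. x i *s v i)"
proof -
  define w where "w = (\<Sum>i\<in>UNIV. x i *s v i)"
  define y where "y = matrix_inv T *v w"
  obtain q a where q: "bij q" and a: "\<And>j. column j T = a j *s v (q j)"
    using eigenmatrix_columns[OF T] by blast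
  define p where "p = inv q"
  have p: "q (p i) = i" for i using q by (simp add: p_def bij_is_surj surj_f_inv_f)
  have "bij p" using q by (simp add: p_def bij_imp_bij_inv)
  have "w = T *v y"
    unfolding y_def using T by (simp add: matrix_inv_mult_vector eigenmatrices_def)
  also have "\<dots> = (\<Sum>j\<in>UNIV. (y $ j * a j) *s v (q j))"
    by (simp add: matrix_mult_sum a)
  also have "\<dots> = (\<Sum>i\<in>UNIV. (y $ p i * a (p i)) *s v i)"
    using sum.reindex_bij_betw[OF \<open>bij p\<close>, of "\<lambda>j. (y $ j * a j) *s v (q j)"] by (simp add: p)
  finally have "x k = y $ p k * a (p k)"
    unfolding w_def by (rule coordinates_unique)
  then have "cmod (x k) = cmod (a (p k)) * cmod (y $ p k)"
    by (simp add: norm_mult)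
  also have "\<dots> \<le> spectral_norm T * (spectral_norm (matrix_inv T) * norm w)"
  proof (intro mult_mono)
    have "cmod (a (p k)) = norm (T *v axis (p k) 1)"
      by (simp add: matrix_vector_mult_axis_one a norm_vector_scalar_mult norm_v)
    also have "\<dots> \<le> spectral_norm T"
      using spectral_norm_bound[of T "axis (p k) 1"] by (simp add: norm_axis_one)
    finally show "cmod (a (p k)) \<le> spectral_norm T" .
    show "cmod (y $ p k) \<le> spectral_norm (matrix_inv T) * norm w"
      using Finite_Cartesian_Product.norm_nth_le[of y "p k"] spectral_norm_bound[of "matrix_inv T" w]
      unfolding y_def by (rule order_trans)
  qed (simp_all add: spectral_norm_nonneg)
  finally show ?thesis by (simp add: cond_number_def w_def)
qed

text \<open>For \<open>M = matrix_inv B ** A\<close> this is \<open>kappa_V A B\<close>.\<close>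

definition kappa :: real where "kappa = Inf (cond_number ` eigenmatrices)"

text \<open>The bound by \<open>cond_number T\<close> holds for every \<open>T\<close>, so after
  division by the norm it passes to the infimum. For the zero vector, independence makes the
  coordinates vanish.\<close>

lemma coordinate_le_kappa: "cmod (x k) \<le> kappa * norm (\<Sum>i\<in>UNIV. x i *s v i)"
proof (cases "(\<Sum>i\<in>UNIV. x i *s v i) = 0")
  case False
  have "cmod (x k) / norm (\<Sum>i\<in>UNIV. x i *s v i) \<le> kappa"
    unfolding kappa_def
  proof (rule cInf_greatest)
    fix r assume "r \<in> cond_number ` eigenmatrices"
    then show "cmod (x k) / norm (\<Sum>i\<in>UNIV. x i *s v i) \<le> r"
      using False coordinate_le_cond_number[of _ x k] by (auto simp: pos_divide_le_eq)
  qed (use V_eigenmatrix in auto)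
  then show ?thesis using False by (simp add: pos_divide_le_eq)
qed (use independent in auto)

text \<open>The unit vector \<open>v k\<close> has \<open>k\<close>-th coordinate 1, so the
  coordinate bound applies to it.\<close>

lemma kappa_ge_1: "1 \<le> kappa"
proof -
  have "(\<Sum>i\<in>UNIV. (if i = k then 1 else 0) *s v i) = v k" for k
  proof -
    have "(\<Sum>i\<in>UNIV. (if i = k then 1 else 0) *s v i) = (\<Sum>i\<in>UNIV. if i = k then v k else 0)"
      by (intro sum.cong) auto
    then show ?thesis by simp
  qed
  then show ?thesis
    using coordinate_le_kappa[of "\<lambda>i. if i = undefined then 1 else 0" undefined] norm_v by simp
qed

text \<open>Stands in for a minimiser of the condition number, at the price of the factor
  \<open>r\<close>.\<close>

lemma kappa_attained_approx:
  assumes "1 < r"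
  obtains T where "T \<in> eigenmatrices" "cond_number T \<le> r * kappa"
proof -
  have "Inf (cond_number ` eigenmatrices) < r * kappa"
    using kappa_ge_1 assms by (simp add: kappa_def[symmetric])
  then obtain c where "c \<in> cond_number ` eigenmatrices" "c < r * kappa"
    using cInf_lessD[of "cond_number ` eigenmatrices"] V_eigenmatrix by blast
  then show ?thesis using that by (auto intro: less_imp_le)
qed

text \<open>Conjugation with \<open>T\<close> turns \<open>M + E\<close> into the diagonal matrix of
  the \<open>l (q j)\<close> plus a matrix of norm at most \<open>cond_number T * \<delta>\<close>.
  The eigenvector found there is mapped back by \<open>T\<close>.\<close>

lemma eigenvalue_localisation:
  assumes T: "T \<in> eigenmatrices" and E: "\<And>x. norm (E *v x) \<le> \<delta> * norm x"
    and g: "10 * (cond_number T * \<delta>) \<le> g" "0 < g" "\<And>i j. i \<noteq> j \<Longrightarrow> g \<le> cmod (l i - l j)"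
  obtains \<mu> x where "x \<noteq> 0" "(M + E) *v x = \<mu> *s x" "cmod (\<mu> - l k) \<le> 5 / 4 * (cond_number T * \<delta>)"
proof -
  obtain q a where q: "bij q" and a: "\<And>j. column j T = a j *s v (q j)"
    using eigenmatrix_columns[OF T] by blast
  have T_inv: "matrix_inv T *v (T *v x) = x" "T *v (matrix_inv T *v x) = x" for x
    using T by (simp_all add: matrix_inv_mult_vector eigenmatrices_def)
  \<comment> \<open>\<open>i\<close> is the column of \<open>T\<close> parallel to
    \<open>v k\<close>.\<close>
  obtain i where i: "q i = k" using q by (metis bij_pointE)
  let ?F = "matrix_inv T ** E ** T"
  have F: "norm (?F *v x) \<le> cond_number T * \<delta> * norm x" for x
  proof -
    have \<delta>: "0 \<le> \<delta>" using order_trans[OF norm_ge_zero E[of "axis i 1"]] by (simp add: norm_axis_one)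
    have "norm (?F *v x) \<le> spectral_norm (matrix_inv T) * norm (E *v (T *v x))"
      using spectral_norm_bound[of "matrix_inv T"] by (simp flip: matrix_vector_mul_assoc)
    also have "\<dots> \<le> spectral_norm (matrix_inv T) * (\<delta> * (spectral_norm T * norm x))"
      using order_trans[OF E mult_left_mono[OF spectral_norm_bound \<delta>]]
      by (intro mult_left_mono spectral_norm_nonneg)
    finally show ?thesis by (simp add: cond_number_def algebra_simps)
  qed
  have sep: "g \<le> cmod (l (q i) - l (q j))" if "j \<noteq> i" for j
    using g(3) that q by (metis bij_def injD)
  obtain \<mu> x where x: "x \<noteq> 0" "\<And>j. l (q j) * x $ j + (?F *v x) $ j = \<mu> * x $ j"
    "cmod (\<mu> - l (q i)) \<le> 5 / 4 * (cond_number T * \<delta>)"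
    using diagonal_perturbation_eigenvector[where d = "\<lambda>j. l (q j)", OF F g(1,2) sep] by blast
  show ?thesis
  proof
    show "T *v x \<noteq> 0" using T_inv(1)[of x] x(1) by auto
    have "M *v (T *v x) = (\<Sum>j\<in>UNIV. x $ j *s (M *v column j T))"
      by (simp add: matrix_mult_sum[of T] matrix_vector_mult_sum_right vector_scalar_commute)
    also have "\<dots> = T *v (\<chi> j. l (q j) * x $ j)"
      by (simp add: matrix_mult_sum[of T] a vector_scalar_commute eigen mult_ac)
    finally have "(M + E) *v (T *v x) = T *v ((\<chi> j. l (q j) * x $ j) + ?F *v x)"
      by (simp add: matrix_vector_mult_add_rdistrib matrix_vector_right_distrib T_inv
          flip: matrix_vector_mul_assoc)
    also have "(\<chi> j. l (q j) * x $ j) + ?F *v x = \<mu> *s x"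
      using x(2) by (simp add: vec_eq_iff)
    finally show "(M + E) *v (T *v x) = \<mu> *s (T *v x)"
      by (simp add: vector_scalar_commute)
    show "cmod (\<mu> - l k) \<le> 5 / 4 * (cond_number T * \<delta>)" using x(3) i by simp
  qed
qed

text \<open>In the basis \<open>v\<close>, the vector \<open>E *v w = \<mu> *s w - M *v w\<close>
  has coordinates \<open>(\<mu> - l i) * x i\<close>, each at most \<open>kappa * \<delta>\<close>.
  Division by \<open>h\<close> bounds all coordinates of \<open>w\<close> except the
  \<open>k\<close>-th; the factor 2 comes from phase alignment.\<close>

lemma eigenvector_perturbation:
  assumes E: "\<And>x. norm (E *v x) \<le> \<delta> * norm x"
    and w: "(M + E) *v w = \<mu> *s w" "norm w = 1"
    and h: "0 < h" "\<And>j. j \<noteq> k \<Longrightarrow> h \<le> cmod (\<mu> - l j)"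
  obtains c where "cmod c = 1" "norm (c *s v k - w) \<le> 2 * (real CARD('n) * (kappa * \<delta> / h))"
proof -
  obtain x where x: "w = (\<Sum>i\<in>UNIV. x i *s v i)" by (rule coordinates)
  have \<delta>: "0 \<le> \<delta>" using order_trans[OF norm_ge_zero E[of w]] w by simp
  have "E *v w = \<mu> *s w - M *v w"
    using w(1) by (simp add: matrix_vector_mult_add_rdistrib algebra_simps)
  also have "\<dots> = (\<Sum>i\<in>UNIV. ((\<mu> - l i) * x i) *s v i)"
    unfolding x mult_coordinates
    by (simp add: vec.scale_sum_right left_diff_distrib vec.scale_left_diff_distrib sum_subtractf)
  finally have Ew: "cmod ((\<mu> - l i) * x i) \<le> kappa * norm (E *v w)" for i
    using coordinate_le_kappa[of "\<lambda>i. (\<mu> - l i) * x i" i] by simp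
  have xi: "cmod (x i) \<le> kappa * \<delta> / h" if "i \<noteq> k" for i
  proof -
    have "h * cmod (x i) \<le> cmod (\<mu> - l i) * cmod (x i)"
      using h(2)[OF that] by (intro mult_right_mono) auto
    also have "\<dots> \<le> kappa * norm (E *v w)" using Ew by (simp add: norm_mult)
    also have "\<dots> \<le> kappa * \<delta>" using E[of w] w(2) kappa_ge_1 by (intro mult_left_mono) auto
    finally show ?thesis using h(1) by (simp add: pos_le_divide_eq mult.commute)
  qed
  have "w - x k *s v k = (\<Sum>i\<in>UNIV - {k}. x i *s v i)"
    unfolding x by (simp add: sum_diff1)
  also have "norm \<dots> \<le> (\<Sum>i\<in>UNIV - {k}. kappa * \<delta> / h)"
    using xi by (intro sum_norm_le) (simp add: norm_vector_scalar_mult norm_v)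
  \<comment> \<open>Adding a term for \<open>k\<close> gives the factor \<open>n\<close> instead of
    \<open>n - 1\<close>.\<close>
  also have "\<dots> \<le> (\<Sum>i\<in>(UNIV :: 'n set). kappa * \<delta> / h)"
    using \<delta> h(1) kappa_ge_1 by (intro sum_mono2) auto
  finally have "norm (w - x k *s v k) \<le> real CARD('n) * (kappa * \<delta> / h)" by simp
  moreover obtain c where "cmod c = 1" "norm (c *s v k - w) \<le> 2 * norm (w - x k *s v k)"
    by (rule phase_alignment[OF norm_v w(2)])
  ultimately show ?thesis by (intro that[of c]) auto
qed

end

section \<open>Perturbation of a pencil\<close>

text \<open>\<open>Bt\<close> times the difference applied to \<open>x\<close> is
  \<open>(B - Bt) *v y - (A - At) *v x\<close> with \<open>y = matrix_inv B *v (A *v x)\<close>.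
  Both terms are at most \<open>\<eta> * sigma_min B * norm x\<close>, and a lower bound for
  \<open>Bt\<close> removes the factor \<open>Bt\<close>. Applied with
  \<open>\<eta> = \<epsilon> * gap A B\<close>.\<close>

lemma pencil_perturbation:
  fixes A B At Bt :: "complex^'n^'n"
  assumes "spectral_norm A \<le> 1" and B: "invertible B"
    and pert_A: "spectral_norm (A - At) \<le> \<eta> * sigma_min B"
    and pert_B: "spectral_norm (B - Bt) \<le> \<eta> * (sigma_min B)\<^sup>2"
    and small: "\<eta> * sigma_min B \<le> 1 / 16"
  shows "invertible Bt"
    and "norm ((matrix_inv Bt ** At - matrix_inv B ** A) *v x) \<le> 5 / 2 * \<eta> * norm x"
proof -
  define s where "s = sigma_min B"
  have s: "0 < s" unfolding s_def by (rule sigma_min_pos) fact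
  have "0 \<le> \<eta> * s" using order_trans[OF spectral_norm_nonneg pert_A] by (simp add: s_def)
  then have \<eta>: "0 \<le> \<eta>" using s by (simp add: zero_le_mult_iff)
  have dB: "norm ((B - Bt) *v y) \<le> \<eta> * s\<^sup>2 * norm y" for y
    using order_trans[OF spectral_norm_bound mult_right_mono[OF pert_B norm_ge_zero]]
    by (simp add: s_def)
  have dA: "norm ((A - At) *v y) \<le> \<eta> * s * norm y" for y
    using order_trans[OF spectral_norm_bound mult_right_mono[OF pert_A norm_ge_zero]]
    by (simp add: s_def)
  \<comment> \<open>The perturbation of \<open>B\<close> is at most
    \<open>\<eta> * s\<^sup>2 \<le> s / 16\<close>.\<close>
  have Bt: "15 / 16 * s * norm y \<le> norm (Bt *v y)" for y
  proof -
    have "s * norm y \<le> norm (B *v y)" unfolding s_def by (rule sigma_min_mult_le)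
    also have "B *v y = Bt *v y + (B - Bt) *v y"
      by (simp add: matrix_vector_mult_diff_rdistrib)
    also have "norm \<dots> \<le> norm (Bt *v y) + \<eta> * s\<^sup>2 * norm y"
      using norm_triangle_ineq dB[of y] by (rule order_trans[OF _ add_left_mono])
    also have "\<eta> * s\<^sup>2 * norm y \<le> 1 / 16 * s * norm y"
      using mult_right_mono[OF small[folded s_def], of s] s
      by (intro mult_right_mono) (auto simp: power2_eq_square)
    finally show ?thesis by (simp add: algebra_simps)
  qed
  show inv: "invertible Bt" using invertible_if_bounded_below[OF _ Bt] s by simp
  let ?E = "matrix_inv Bt ** At - matrix_inv B ** A"
  let ?y = "matrix_inv B *v (A *v x)"
  have "s * norm ?y \<le> norm (B *v ?y)" unfolding s_def by (rule sigma_min_mult_le)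
  also have "\<dots> = norm (A *v x)" using matrix_inv_mult_vector(2)[OF B] by simp
  also have "\<dots> \<le> 1 * norm x"
    using order_trans[OF spectral_norm_bound mult_right_mono[OF assms(1) norm_ge_zero]] .
  finally have y: "s * norm ?y \<le> norm x" by simp
  have "Bt *v (?E *v x) = At *v x - Bt *v ?y"
    using matrix_inv_mult_vector(2)[OF inv]
    by (simp add: matrix_vector_mult_diff_rdistrib matrix_vector_mult_diff_distrib
        flip: matrix_vector_mul_assoc)
  also have "\<dots> = (B - Bt) *v ?y - (A - At) *v x"
    using matrix_inv_mult_vector(2)[OF B] by (simp add: matrix_vector_mult_diff_rdistrib)
  also have "norm \<dots> \<le> norm ((B - Bt) *v ?y) + norm ((A - At) *v x)"
    by (rule norm_triangle_ineq4)
  also have "\<dots> \<le> \<eta> * s\<^sup>2 * norm ?y + \<eta> * s * norm x"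
    by (intro add_mono dA dB)
  also have "\<eta> * s\<^sup>2 * norm ?y = \<eta> * s * (s * norm ?y)" by (simp add: power2_eq_square)
  also have "\<dots> \<le> \<eta> * s * norm x" using y \<open>0 \<le> \<eta> * s\<close> by (intro mult_left_mono)
  finally have "norm (Bt *v (?E *v x)) \<le> s * (2 * \<eta> * norm x)" by (simp add: mult_ac)
  with Bt[of "?E *v x"] have "15 / 16 * s * norm (?E *v x) \<le> s * (2 * \<eta> * norm x)"
    by (rule order_trans)
  then have "s * (15 / 16 * norm (?E *v x)) \<le> s * (2 * \<eta> * norm x)" by simp
  then have "15 / 16 * norm (?E *v x) \<le> 2 * \<eta> * norm x"
    using s by (simp only: mult_le_cancel_left_pos)
  \<comment> \<open>This sign allows weakening the constant \<open>2 * 16 / 15 = 32 / 15\<close> to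
    \<open>5 / 2\<close>.\<close>
  moreover have "0 \<le> \<eta> * norm x" using \<eta> by simp
  ultimately show "norm (?E *v x) \<le> 5 / 2 * \<eta> * norm x" by simp
qed

text \<open>\<open>z *s (B *v x)\<close> equals \<open>A *v x\<close>, of norm at most
  \<open>norm x\<close>, while \<open>norm (B *v x)\<close> is at least
  \<open>sigma_min B * norm x\<close>. This yields the bound \<open>2 / sigma_min B\<close> on the
  gap.\<close>

lemma eigenvalue_mult_sigma_min_le:
  assumes "spectral_norm A \<le> 1" "eigenpair A B z x"
  shows "cmod z * sigma_min B \<le> 1"
proof -
  have x: "A *v x = z *s (B *v x)" "0 < norm x" using assms(2) by (auto simp: eigenpair_def)
  have "cmod z * sigma_min B * norm x \<le> cmod z * norm (B *v x)"
    using mult_left_mono[OF sigma_min_mult_le[of B x] norm_ge_zero[of z]] by (simp add: mult.assoc)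
  also have "\<dots> = norm (A *v x)" by (simp add: x(1) norm_vector_scalar_mult)
  also have "\<dots> \<le> 1 * norm x"
    using order_trans[OF spectral_norm_bound mult_right_mono[OF assms(1) norm_ge_zero]] .
  finally show ?thesis using x(2) by simp
qed

theorem theorem5p2:
  fixes A B At Bt :: "complex^'n^'n"
    and l :: "'n \<Rightarrow> complex" and v :: "'n \<Rightarrow> complex^'n" and \<epsilon> :: real
  assumes n_ge_2: "CARD('n) \<ge> 2"
    and norm_A: "spectral_norm A \<le> 1"
    and inv_B: "invertible B"
    and distinct: "distinct_finite_eigenvalues A B"
    and pairs: "unit_eigenpairs A B l v"
    and pert_A: "spectral_norm (A - At) \<le> \<epsilon> * sigma_min B * gap A B"
    and pert_B: "spectral_norm (B - Bt) \<le> \<epsilon> * (sigma_min B)\<^sup>2 * gap A B"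
    and eps: "\<epsilon> \<le> 1 / (32 * kappa_V A B)"
  shows "distinct_finite_eigenvalues At Bt \<and>
    (\<forall>lt vt. unit_eigenpairs At Bt lt vt \<longrightarrow>
      (\<exists>(p :: 'n \<Rightarrow> 'n) (c :: 'n \<Rightarrow> complex). bij p \<and> (\<forall>i. cmod (c i) = 1) \<and>
        (\<forall>i. cmod (l i - lt (p i)) \<le> 4 * gap A B * kappa_V A B * \<epsilon> \<and>
             norm (c i *s v i - vt (p i)) \<le> 24 * real CARD('n) * kappa_V A B * \<epsilon>)))"
proof -
  define g where "g = gap A B"
  define M where "M = matrix_inv B ** A"
  define E where "E = matrix_inv Bt ** At - M"
  have l: "pencil_eigenvalues A B = image_mset l (mset_set UNIV)"
    and lv: "\<And>i. eigenpair A B (l i) (v i)" "\<And>i. norm (v i) = 1"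
    using pairs by (simp_all add: unit_eigenpairs_def)
  have "inj l" using distinct distinct_finite_eigenvalues_iff_inj[OF l] by simp
  interpret eigenbasis M l v
    using lv \<open>inj l\<close> by unfold_locales (auto simp: eigenpair_iff[OF inv_B] M_def)
  have kappa_V: "kappa_V A B = kappa"
    unfolding kappa_V_def kappa_def eigenmatrices_def eigenpair_iff[OF inv_B] M_def[symmetric]
    by (rule arg_cong[where f = Inf]) auto
  have g: "0 < g" "\<And>i j. i \<noteq> j \<Longrightarrow> g \<le> cmod (l i - l j)"
    unfolding g_def using gap_pos[OF n_ge_2 l \<open>inj l\<close>] gap_le[OF l] by auto
  have \<sigma>: "0 < sigma_min B" using inv_B by (rule sigma_min_pos)
  have "0 \<le> \<epsilon> * sigma_min B * g"
    unfolding g_def by (rule order_trans[OF spectral_norm_nonneg pert_A])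
  then have \<epsilon>: "0 \<le> \<epsilon>" using \<sigma> g(1) by (simp add: zero_le_mult_iff)
  have \<epsilon>\<kappa>: "\<epsilon> * kappa \<le> 1 / 32"
    using eps kappa_ge_1 by (simp add: kappa_V field_simps)
  have "\<epsilon> * 1 \<le> \<epsilon> * kappa" using kappa_ge_1 \<epsilon> by (rule mult_left_mono)
  then have "\<epsilon> \<le> 1 / 32" using \<epsilon>\<kappa> by simp

  obtain i j :: 'n where "i \<noteq> j"
    using n_ge_2 by (metis One_nat_def card_le_Suc0_iff_eq finite not_less_eq_eq numeral_2_eq_2 UNIV_I)
  \<comment> \<open>The gap is at most the sum of two eigenvalue moduli. With
    \<open>\<epsilon> \<le> 1 / 32\<close> this yields the smallness \<open>1 / 16\<close> that
    \<open>pencil_perturbation\<close> requires.\<close>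
  have "g * sigma_min B \<le> (cmod (l i) + cmod (l j)) * sigma_min B"
    using g(2)[OF \<open>i \<noteq> j\<close>] norm_triangle_ineq4[of "l i" "l j"] \<sigma> by (intro mult_right_mono) auto
  also have "\<dots> \<le> 2"
    using eigenvalue_mult_sigma_min_le[OF norm_A lv(1), of i]
      eigenvalue_mult_sigma_min_le[OF norm_A lv(1), of j] by (simp add: distrib_right)
  finally have "\<epsilon> * (g * sigma_min B) \<le> 1 / 32 * 2"
    using \<open>\<epsilon> \<le> 1 / 32\<close> \<epsilon> \<sigma> g(1) by (intro mult_mono) auto
  then have "\<epsilon> * g * sigma_min B \<le> 1 / 16" by (simp add: mult.assoc)
  then have inv_Bt: "invertible Bt" and E: "\<And>x. norm (E *v x) \<le> 5 / 2 * (\<epsilon> * g) * norm x"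
    using pencil_perturbation[OF norm_A inv_B, where \<eta> = "\<epsilon> * g" and At = At and Bt = Bt]
      pert_A pert_B by (simp_all add: E_def M_def g_def mult_ac)
  have ME: "M + E = matrix_inv Bt ** At" by (simp add: E_def)

  \<comment> \<open>The factor \<open>6 / 5\<close> turns the \<open>5 / 2\<close> in the bound on
    \<open>E\<close> into 3. Then \<open>10 * 3 / 32 \<le> 1\<close> is what localisation requires,
    and \<open>5 / 4 * 3 \<le> 4\<close> gives the eigenvalue bound.\<close>
  obtain T where T: "T \<in> eigenmatrices" "cond_number T \<le> 6 / 5 * kappa"
    using kappa_attained_approx[of "6 / 5"] by auto
  have "cond_number T * (5 / 2 * (\<epsilon> * g)) \<le> 6 / 5 * kappa * (5 / 2 * (\<epsilon> * g))"
    using T(2) \<epsilon> g(1) by (intro mult_right_mono) auto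
  then have r: "cond_number T * (5 / 2 * (\<epsilon> * g)) \<le> 3 * (\<epsilon> * kappa * g)" by (simp add: mult_ac)
  have \<epsilon>\<kappa>g: "\<epsilon> * kappa * g \<le> 1 / 32 * g" "0 \<le> \<epsilon> * kappa * g"
    using \<epsilon>\<kappa> g(1) \<epsilon> kappa_ge_1 by (auto intro!: mult_right_mono)
  have "10 * (cond_number T * (5 / 2 * (\<epsilon> * g))) \<le> g" using r \<epsilon>\<kappa>g g(1) by linarith
  from eigenvalue_localisation[OF T(1) E this g]
  have "\<exists>\<mu> x. x \<noteq> 0 \<and> (M + E) *v x = \<mu> *s x \<and>
      cmod (\<mu> - l k) \<le> 5 / 4 * (cond_number T * (5 / 2 * (\<epsilon> * g)))" for k by metis
  then obtain \<mu> X where X: "\<And>k. X k \<noteq> 0" "\<And>k. (M + E) *v X k = \<mu> k *s X k"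
    and \<mu>0: "\<And>k. cmod (\<mu> k - l k) \<le> 5 / 4 * (cond_number T * (5 / 2 * (\<epsilon> * g)))" by metis
  have \<mu>: "cmod (\<mu> k - l k) \<le> 4 * (\<epsilon> * kappa * g)" for k
    using \<mu>0[of k] r \<epsilon>\<kappa>g(2) by linarith
  \<comment> \<open>\<open>\<mu> i\<close> is within \<open>4 / 32 * g = g / 8\<close> of
    \<open>l i\<close>.\<close>
  have \<mu>_sep: "7 / 8 * g \<le> cmod (\<mu> i - l j)" if "j \<noteq> i" for i j
    using g(2)[of i j] that norm_triangle_ineq[of "l i - \<mu> i" "\<mu> i - l j"] \<mu>[of i] \<epsilon>\<kappa>g(1)
    by (simp add: norm_minus_commute)
  \<comment> \<open>A common value would lie within \<open>g / 8\<close> of \<open>l j\<close> and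
    at least \<open>7 / 8 * g\<close> away from it.\<close>
  have "inj \<mu>"
  proof (rule injI, rule ccontr)
    fix i j assume "\<mu> i = \<mu> j" "i \<noteq> j"
    then have "7 / 8 * g \<le> cmod (\<mu> j - l j)" using \<mu>_sep[of j i] by simp
    then show False using \<mu>[of j] \<epsilon>\<kappa>g(1) g(1) by linarith
  qed
  have "\<exists>x. eigenpair At Bt (\<mu> i) x" for i
    unfolding eigenpair_iff[OF inv_Bt] ME[symmetric] using X by blast
  then have eig_t: "pencil_eigenvalues At Bt = image_mset \<mu> (mset_set UNIV)"
    by (rule pencil_eigenvalues_eq_image_mset[OF inv_Bt \<open>inj \<mu>\<close>])
  have dist_t: "distinct_finite_eigenvalues At Bt"
    unfolding distinct_finite_eigenvalues_iff_inj[OF eig_t] by fact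
  show ?thesis
  proof (intro conjI allI impI dist_t)
    fix lt :: "'n \<Rightarrow> complex" and vt :: "'n \<Rightarrow> complex^'n"
    assume "unit_eigenpairs At Bt lt vt"
    then have lt: "pencil_eigenvalues At Bt = image_mset lt (mset_set UNIV)"
      and vt: "\<And>i. eigenpair At Bt (lt i) (vt i)" "\<And>i. norm (vt i) = 1"
      by (simp_all add: unit_eigenpairs_def)
    \<comment> \<open>Both families enumerate the same spectrum; \<open>p\<close> sends
      \<open>i\<close> to the position in \<open>lt\<close> of \<open>\<mu> i\<close>, the
      eigenvalue near \<open>l i\<close>.\<close>
    have "range lt = range \<mu>"
      using arg_cong[OF lt[unfolded eig_t], of set_mset] by simp
    then have "\<forall>i. \<exists>j. lt j = \<mu> i" by (metis rangeE rangeI)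
    then obtain p where p: "\<And>i. lt (p i) = \<mu> i" by metis
    then have "inj p" using \<open>inj \<mu>\<close> by (metis injD injI)
    then have "bij p" by (simp add: bij_def finite_UNIV_inj_surj)
    have "\<exists>c. cmod c = 1 \<and> norm (c *s v i - vt (p i)) \<le> 24 * real CARD('n) * kappa * \<epsilon>" for i
    proof -
      have "(M + E) *v vt (p i) = \<mu> i *s vt (p i)"
        using vt(1)[of "p i"] by (simp add: eigenpair_iff[OF inv_Bt] ME p)
      \<comment> \<open>With \<open>h = 7 / 8 * g\<close> the gap cancels, leaving
        \<open>2 * (5 / 2) / (7 / 8) = 40 / 7\<close>, well below 24.\<close>
      from eigenvector_perturbation[OF E this vt(2) _ \<mu>_sep[of _ i]] g(1)
      obtain c where "cmod c = 1"
        and c: "norm (c *s v i - vt (p i))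
          \<le> 2 * (real CARD('n) * (kappa * (5 / 2 * (\<epsilon> * g)) / (7 / 8 * g)))" by auto
      note c
      also have "2 * (real CARD('n) * (kappa * (5 / 2 * (\<epsilon> * g)) / (7 / 8 * g)))
          = 40 / 7 * (real CARD('n) * kappa * \<epsilon>)"
        using g(1) by simp
      also have "\<dots> \<le> 24 * (real CARD('n) * kappa * \<epsilon>)"
        using kappa_ge_1 \<epsilon> by (intro mult_right_mono) auto
      finally show ?thesis using \<open>cmod c = 1\<close> by (auto simp: mult.assoc)
    qed
    then obtain c where "\<And>i. cmod (c i) = 1"
      "\<And>i. norm (c i *s v i - vt (p i)) \<le> 24 * real CARD('n) * kappa * \<epsilon>" by metis
    moreover have "cmod (l i - lt (p i)) \<le> 4 * gap A B * kappa * \<epsilon>" for i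
      using \<mu>[of i] by (simp add: p norm_minus_commute g_def mult_ac)
    ultimately show "\<exists>(p :: 'n \<Rightarrow> 'n) (c :: 'n \<Rightarrow> complex). bij p \<and> (\<forall>i. cmod (c i) = 1) \<and>
        (\<forall>i. cmod (l i - lt (p i)) \<le> 4 * gap A B * kappa_V A B * \<epsilon> \<and>
             norm (c i *s v i - vt (p i)) \<le> 24 * real CARD('n) * kappa_V A B * \<epsilon>)"
      unfolding kappa_V using \<open>bij p\<close> by blast
  qed
qed

end
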